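(* For every integer $n\ge 2$, $$\sum_{k=1}^{\infty}\frac{\zeta(2k)}{k\,F_{2n}^{4k}}=\ln\left(\frac{\pi}{F_{2n}^2}\right)+\ln\csc\left(\frac{\pi}{F_{2n}^2}\right),$$ and for every integer $n\ge 2$, $$\sum_{k=2}^{\infty}\frac{\zeta(k)}{k\,(F_nL_n)^k}=\ln\Gamma\left(\frac{F_{2n}-1}{F_{2n}}\right)-\frac{\gamma}{F_{2n}}.$$
   Context: $\zeta$ denotes the Riemann zeta function, $\Gamma$ the gamma function, and $\gamma$ the Euler-Mascheroni constant. $F_n$ and $L_n$ denote the Fibonacci and Lucas numbers: both satisfy $x_n=x_{n-1}+x_{n-2}$ for $n\ge 2$, with $F_0=0$, $F_1=1$ and $L_0=2$, $L_1=1$. *)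

theory Defs
  imports "HOL-Analysis.Analysis" "HOL-Number_Theory.Fib"
begin

(* The Riemann zeta function on its half-plane of absolute convergence: the value is the
   intended one for real s > 1, resp. for complex s with Re s > 1. The analytic continuation
   is not covered; outside this range the value is that of a divergent series. *)
definition zeta :: "'a::{real_normed_field, ln} \<Rightarrow> 'a" where
  "zeta s = (\<Sum>m. 1 / of_nat (Suc m) powr s)"

fun lucas :: "nat \<Rightarrow> nat" where
  "lucas 0 = 2"
| "lucas (Suc 0) = 1"
| "lucas (Suc (Suc n)) = lucas (Suc n) + lucas n"

definition csc :: "'a::{real_normed_field, banach} \<Rightarrow> 'a" where
  "csc x = 1 / sin x"

end

theory Submission
  imports Defs
begin

text \<open>
  Both identities are specialisations of one power series: for real \<open>\<bar>x\<bar> < 1\<close>,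
  \[ \sum_{k \ge 2} \frac{\zeta(k)}{k} x^k = \ln \Gamma(1 - x) - \gamma x. \]
  It holds because inserting \<open>\<zeta>(k) = (\<Sum>m\<ge>1. 1 / m ^ k)\<close> and exchanging the two summations
  (lemma \<open>sums_swap_of_bound\<close>) turns the left-hand side into
  \<open>\<Sum>m\<ge>1. (- ln (1 - x / m) - x / m)\<close>, by the Taylor series of the logarithm; and this sum is the
  logarithm of the Weierstrass product for \<open>\<Gamma> (1 - x)\<close>, up to the factor \<open>exp (- \<gamma> * x)\<close>
  (lemma \<open>sums_ln_Gamma_one_minus\<close>).

  The second identity is the case \<open>x = 1 / F\<^bsub>2n\<^esub>\<close>, since \<open>F\<^sub>n L\<^sub>n = F\<^bsub>2n\<^esub>\<close>. For the first one, adding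
  the series at \<open>x\<close> and at \<open>-x\<close> cancels \<open>\<gamma>\<close> and the odd powers and leaves
  \<open>ln (\<Gamma> (1 - x) * \<Gamma> (1 + x))\<close>. By the reflection formula this is
  \<open>ln (\<pi> x / sin (\<pi> x))\<close>, and \<open>x = 1 / F\<^bsub>2n\<^esub>\<^sup>2\<close> gives the claim.
\<close>

section \<open>Exchanging two summations\<close>

text \<open>
  A product majorant \<open>a m * b k\<close> with both factors summable makes the double family absolutely
  summable over all pairs, so its sum may be computed by rows or by columns.
\<close>
lemma sums_swap_of_bound:
  fixes f :: "nat \<Rightarrow> nat \<Rightarrow> real"
  assumes a: "summable a" and b: "summable b"
    and bound: "\<And>m k. \<bar>f m k\<bar> \<le> a m * b k"
    and a_nonneg: "\<And>m. 0 \<le> a m" and b_nonneg: "\<And>k. 0 \<le> b k"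
    and rows: "\<And>m. f m sums r m"
    and total: "r sums S"
    and cols: "\<And>k. (\<lambda>m. f m k) sums c k"
  shows "c sums S"
proof -
  have "(b has_sum suminf b) UNIV"
    using b b_nonneg by (intro sums_nonneg_imp_has_sum) auto
  moreover have "a summable_on UNIV"
    using a a_nonneg by (intro norm_summable_imp_summable_on) simp
  ultimately have "(\<lambda>(m, k). a m * b k) summable_on (UNIV \<times> UNIV)"
    using a_nonneg b_nonneg
    by (intro summable_on_SigmaI[where g = "\<lambda>m. a m * suminf b"])
       (auto intro!: has_sum_cmult_right summable_on_cmult_left)
  then have "(\<lambda>p. norm (case p of (m, k) \<Rightarrow> f m k)) summable_on (UNIV \<times> UNIV)"
    by (rule Infinite_Sum.abs_summable_on_comparison_test') (use bound in auto)
  then have "(\<lambda>(m, k). f m k) summable_on (UNIV \<times> UNIV)"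
    by (rule abs_summable_summable)
  then obtain T where T: "((\<lambda>(m, k). f m k) has_sum T) (UNIV \<times> UNIV)"
    by (auto simp: summable_on_def)
  have row_sum: "(f m has_sum r m) UNIV" for m
  proof (rule norm_summable_imp_has_sum[OF _ rows])
    show "summable (\<lambda>k. norm (f m k))"
      using bound by (intro summable_comparison_test'[OF summable_mult[OF b, of "a m"]]) auto
  qed
  have col_sum: "((\<lambda>m. f m k) has_sum c k) UNIV" for k
  proof (rule norm_summable_imp_has_sum[OF _ cols])
    show "summable (\<lambda>m. norm (f m k))"
      using bound by (intro summable_comparison_test'[OF summable_mult2[OF a, of "b k"]]) auto
  qed
  have "(r has_sum T) UNIV"
    by (rule has_sum_SigmaD[OF T]) (simp add: row_sum)
  then have "T = S"
    using has_sum_imp_sums sums_unique2 total by blast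
  moreover have "((\<lambda>(k, m). f m k) has_sum T) (UNIV \<times> UNIV)"
    using T by (subst (asm) has_sum_swap) (simp add: case_prod_unfold)
  then have "(c has_sum T) UNIV"
    by (rule has_sum_SigmaD) (simp add: col_sum)
  ultimately show ?thesis
    using has_sum_imp_sums by blast
qed

section \<open>The generating function of the zeta values\<close>

lemma summable_inverse_Suc_power2: "summable (\<lambda>m. 1 / real (Suc m) ^ 2)"
proof -
  have "summable (\<lambda>n. inverse (real n ^ 2))" by (rule inverse_power_summable) simp
  then have "summable (\<lambda>m. inverse (real (Suc m) ^ 2))" by (subst summable_Suc_iff)
  then show ?thesis by (simp only: inverse_eq_divide)
qed

text \<open>For integer arguments the real powers in the definition of \<open>\<zeta>\<close> are ordinary ones.\<close>
lemma zeta_of_nat_sums: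
  assumes "k \<ge> 2"
  shows "(\<lambda>m. 1 / real (Suc m) ^ k) sums zeta (real k)"
proof -
  have "1 / real (Suc m) ^ k \<le> 1 / real (Suc m) ^ 2" for m
    using assms by (intro divide_left_mono power_increasing) auto
  then have "summable (\<lambda>m. 1 / real (Suc m) ^ k)"
    by (intro summable_comparison_test'[OF summable_inverse_Suc_power2]) auto
  moreover have "zeta (real k) = (\<Sum>m. 1 / real (Suc m) ^ k)"
    unfolding zeta_def by (intro suminf_cong) (simp only: powr_realpow of_nat_0_less_iff zero_less_Suc)
  ultimately show ?thesis by (simp add: summable_sums)
qed

lemma ln_one_minus_tail_sums:
  fixes y :: real
  assumes "\<bar>y\<bar> < 1"
  shows "(\<lambda>j. y ^ (j + 2) / real (j + 2)) sums (- ln (1 - y) - y)"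
proof -
  have "(\<lambda>n. - (y ^ n) / real n) sums ln (1 - y)"
    using ln_series'[of "- y"] assms by simp
  then have "(\<lambda>n. y ^ n / real n) sums (- ln (1 - y))"
    using sums_minus by fastforce
  from sums_split_initial_segment[OF this, of 2] show ?thesis
    by (simp add: numeral_2_eq_2)
qed

text \<open>
  This is the logarithm of Weierstrass' product for \<open>\<Gamma> (- x)\<close>. Its factor \<open>-1 / x\<close> is absorbed by
  the functional equation \<open>\<Gamma> (1 - x) = - x * \<Gamma> (- x)\<close>; only \<open>x = 0\<close>, where \<open>\<Gamma> (- x)\<close> has its
  pole, has to be treated apart.
\<close>
lemma sums_ln_Gamma_one_minus:
  fixes x :: real
  assumes x: "\<bar>x\<bar> < 1"
  shows "(\<lambda>m. - ln (1 - x / real (Suc m)) - x / real (Suc m)) sums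
           (ln (Gamma (1 - x)) - euler_mascheroni * x)"
proof (cases "x = 0")
  case False
  define P where "P n = (\<Prod>k=1..n. exp (- x / real k) / (1 - x / real k))" for n
  have pos: "1 - x / real k > 0" if "k \<ge> 1" for k
  proof -
    have "x < real k" using x that by linarith
    then show ?thesis using that by (simp add: field_simps)
  qed
  have "- x \<notin> \<int>\<^sub>\<le>\<^sub>0"
  proof
    assume "- x \<in> \<int>\<^sub>\<le>\<^sub>0"
    then obtain n where "x = real n" by (elim nonpos_Ints_cases') simp
    with x False show False by simp
  qed
  then have fe: "Gamma (1 - x) = - x * Gamma (- x)"
    using Gamma_plus1[of "- x"] by simp
  have "(\<lambda>n. - x * exp (- euler_mascheroni * x) * Gamma_series_Weierstrass (- x) n)
          \<longlonglongrightarrow> - x * exp (- euler_mascheroni * x) * Gamma (- x)"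
    by (intro tendsto_intros Gamma_Weierstrass_real)
  also have "(\<lambda>n. - x * exp (- euler_mascheroni * x) * Gamma_series_Weierstrass (- x) n) = P"
    using False by (auto simp: Gamma_series_Weierstrass_def P_def fun_eq_iff exp_minus)
  also have "- x * exp (- euler_mascheroni * x) * Gamma (- x)
               = exp (- euler_mascheroni * x) * Gamma (1 - x)"
    by (simp add: fe)
  finally have "P \<longlonglongrightarrow> exp (- euler_mascheroni * x) * Gamma (1 - x)" .
  moreover have G: "Gamma (1 - x) > 0" using x by simp
  ultimately have "(\<lambda>n. ln (P n)) \<longlonglongrightarrow> ln (exp (- euler_mascheroni * x) * Gamma (1 - x))"
    by (intro tendsto_ln) auto
  also have "ln (exp (- euler_mascheroni * x) * Gamma (1 - x))
               = ln (Gamma (1 - x)) - euler_mascheroni * x"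
    using G by (simp add: ln_mult)
  also have "(\<lambda>n. ln (P n)) = (\<lambda>n. \<Sum>m<n. - ln (1 - x / real (Suc m)) - x / real (Suc m))"
  proof
    fix n
    have "ln (P n) = (\<Sum>k=1..n. ln (exp (- x / real k) / (1 - x / real k)))"
      unfolding P_def using pos by (intro ln_prod) auto
    also have "\<dots> = (\<Sum>k=1..n. - ln (1 - x / real k) - x / real k)"
      using pos by (intro sum.cong) (auto simp: ln_div)
    also have "\<dots> = (\<Sum>m<n. - ln (1 - x / real (Suc m)) - x / real (Suc m))"
      by (intro sum.reindex_bij_witness[of _ Suc "\<lambda>k. k - 1"]) auto
    finally show "ln (P n) = \<dots>" .
  qed
  finally show ?thesis by (simp add: sums_def)
qed simp

text \<open>
  Expanding \<open>ln (1 - x / m)\<close> gives the terms \<open>(x / m) ^ k / k\<close>. As \<open>k \<ge> 2\<close>, they are dominated by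
  \<open>\<bar>x\<bar> ^ k / m ^ 2\<close>, which is what the exchange of summations needs.
\<close>
lemma zeta_generating_function:
  fixes x :: real
  assumes x: "\<bar>x\<bar> < 1"
  shows "(\<lambda>j. zeta (real (j + 2)) * x ^ (j + 2) / real (j + 2)) sums
           (ln (Gamma (1 - x)) - euler_mascheroni * x)"
proof (rule sums_swap_of_bound)
  let ?f = "\<lambda>m j. (x / real (Suc m)) ^ (j + 2) / real (j + 2)"
  show "summable (\<lambda>m. 1 / real (Suc m) ^ 2)"
    by (rule summable_inverse_Suc_power2)
  show "summable (\<lambda>j. \<bar>x\<bar> ^ (j + 2))"
    using x by (intro summable_ignore_initial_segment summable_geometric) simp
  show "\<bar>?f m j\<bar> \<le> 1 / real (Suc m) ^ 2 * \<bar>x\<bar> ^ (j + 2)" for m j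
  proof -
    have "\<bar>?f m j\<bar> = \<bar>x\<bar> ^ (j + 2) / (real (Suc m) ^ (j + 2) * real (j + 2))"
      by (simp add: power_divide abs_mult power_abs del: power_Suc of_nat_Suc)
    also have "\<dots> \<le> \<bar>x\<bar> ^ (j + 2) / (real (Suc m) ^ 2 * 1)"
      by (intro divide_left_mono mult_mono power_increasing mult_pos_pos) auto
    finally show ?thesis by simp
  qed
  show "?f m sums (- ln (1 - x / real (Suc m)) - x / real (Suc m))" for m
  proof (rule ln_one_minus_tail_sums)
    have "\<bar>x\<bar> < real (Suc m)" using x by linarith
    then show "\<bar>x / real (Suc m)\<bar> < 1" by simp
  qed
  show "(\<lambda>m. - ln (1 - x / real (Suc m)) - x / real (Suc m)) sums
          (ln (Gamma (1 - x)) - euler_mascheroni * x)"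
    using x by (rule sums_ln_Gamma_one_minus)
  show "(\<lambda>m. ?f m j) sums (zeta (real (j + 2)) * x ^ (j + 2) / real (j + 2))" for j
    using sums_mult2[OF zeta_of_nat_sums[of "j + 2"], of "x ^ (j + 2) / real (j + 2)"]
    by (simp add: power_divide del: power_Suc of_nat_Suc of_nat_add)
qed auto

text \<open>
  Reflection at \<open>x\<close>, with \<open>\<Gamma> x\<close> traded for \<open>\<Gamma> (1 + x) / x\<close>: these are the two Gamma values that
  the generating function produces at \<open>x\<close> and \<open>-x\<close>.
\<close>
lemma Gamma_one_minus_times_one_plus:
  fixes x :: real
  assumes "x \<notin> \<int>"
  shows "Gamma (1 - x) * Gamma (1 + x) = pi * x / sin (pi * x)"
proof -
  have "complex_of_real (Gamma x * Gamma (1 - x)) = of_real (pi / sin (pi * x))"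
    using Gamma_reflection_complex[of "of_real x"]
    by (simp flip: Gamma_complex_of_real sin_of_real)
  then have "Gamma x * Gamma (1 - x) = pi / sin (pi * x)"
    by (simp only: of_real_eq_iff)
  moreover have "Gamma (1 + x) = x * Gamma x"
    using Gamma_plus1[of x] assms nonpos_Ints_Int by (auto simp: add.commute)
  ultimately show ?thesis by (simp add: mult.assoc mult.commute mult.left_commute)
qed

text \<open>
  This is the sum of the generating functions at \<open>x\<close> and \<open>-x\<close>: the odd powers cancel, the even ones
  double, and the 2 is absorbed by the exponent in the denominator.
\<close>
lemma zeta_even_generating_function:
  fixes x :: real
  assumes x: "0 < x" "x < 1"
  shows "(\<lambda>j. zeta (real (2 * (j + 1))) * x ^ (2 * (j + 1)) / real (j + 1)) sums
           (ln (pi * x) + ln (csc (pi * x)))"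
proof -
  let ?g = "\<lambda>j. zeta (real (j + 2)) * x ^ (j + 2) / real (j + 2)
              + zeta (real (j + 2)) * (- x) ^ (j + 2) / real (j + 2)"
  have "?g sums ((ln (Gamma (1 - x)) - euler_mascheroni * x)
                  + (ln (Gamma (1 - (- x))) - euler_mascheroni * (- x)))"
    using x by (intro sums_add zeta_generating_function) auto
  also have "(ln (Gamma (1 - x)) - euler_mascheroni * x)
               + (ln (Gamma (1 - (- x))) - euler_mascheroni * (- x))
             = ln (Gamma (1 - x) * Gamma (1 + x))"
    using x Gamma_real_pos[of "1 - x"] Gamma_real_pos[of "1 + x"] by (simp add: ln_mult_pos)
  also have "Gamma (1 - x) * Gamma (1 + x) = pi * x / sin (pi * x)"
    using x by (intro Gamma_one_minus_times_one_plus) (auto elim!: Ints_cases)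
  also have "ln (pi * x / sin (pi * x)) = ln (pi * x) + ln (csc (pi * x))"
    using x sin_gt_zero[of "pi * x"] by (simp add: csc_def ln_div)
  finally have "?g sums (ln (pi * x) + ln (csc (pi * x)))" .
  moreover have "?g j = 0" if "j \<notin> range (\<lambda>i. 2 * i)" for j
  proof -
    have "odd j" using that by (auto elim!: evenE)
    then show ?thesis by simp
  qed
  ultimately have "(\<lambda>i. ?g (2 * i)) sums (ln (pi * x) + ln (csc (pi * x)))"
    by (subst sums_mono_reindex) (auto simp: strict_mono_def)
  moreover have "?g (2 * i) = zeta (real (2 * (i + 1))) * x ^ (2 * (i + 1)) / real (i + 1)" for i
  proof -
    have "2 * i + 2 = 2 * (i + 1)" by simp
    moreover have "(- x) ^ (2 * (i + 1)) = x ^ (2 * (i + 1))"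
      by (simp only: power_mult power2_minus)
    moreover have "a / real (2 * c) + a / real (2 * c) = a / real c" for a c
      by simp
    ultimately show ?thesis by (simp only:)
  qed
  ultimately show ?thesis by simp
qed

section \<open>Fibonacci and Lucas numbers\<close>

lemma lucas_Suc: "lucas (Suc n) = fib n + fib (Suc (Suc n))"
  by (induction n rule: fib.induct) auto

lemma fib_times_lucas: "fib n * lucas n = fib (2 * n)"
proof (cases n)
  case (Suc m)
  then show ?thesis
    using fib_rec_even[of n] by (simp add: lucas_Suc mult.commute del: fib.simps)
qed simp

lemma fib_double_gt_1:
  assumes "n \<ge> 2"
  shows "fib (2 * n) > 1"
proof -
  have "fib 4 \<le> fib (2 * n)" using assms by (intro fib_mono) auto
  then show ?thesis by (simp add: numeral_eq_Suc)
qed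

theorem mainTheorem4:
  shows "(\<forall>n::nat. n \<ge> 2 \<longrightarrow>
           (\<lambda>j. let k = j + 1 in
              zeta (real (2 * k)) / (real k * real (fib (2 * n)) ^ (4 * k)))
           sums (ln (pi / real (fib (2 * n)) ^ 2) + ln (csc (pi / real (fib (2 * n)) ^ 2))))
       \<and> (\<forall>n::nat. n \<ge> 2 \<longrightarrow>
           (\<lambda>j. let k = j + 2 in
              zeta (real k) / (real k * (real (fib n) * real (lucas n)) ^ k))
           sums (ln (Gamma ((real (fib (2 * n)) - 1) / real (fib (2 * n))))
                 - euler_mascheroni / real (fib (2 * n))))"
proof (intro conjI allI impI)
  fix n :: nat
  assume n: "n \<ge> 2"
  define F where "F = real (fib (2 * n))"
  have F: "F > 1" using fib_double_gt_1[OF n] by (simp add: F_def)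
  then have "(\<lambda>j. zeta (real (2 * (j + 1))) * (1 / F ^ 2) ^ (2 * (j + 1)) / real (j + 1)) sums
          (ln (pi * (1 / F ^ 2)) + ln (csc (pi * (1 / F ^ 2))))"
    by (intro zeta_even_generating_function) auto
  moreover have "zeta (real (2 * k)) * (1 / F ^ 2) ^ (2 * k) / real k
                   = zeta (real (2 * k)) / (real k * F ^ (4 * k))" for k
    by (simp add: power_divide flip: power_mult)
  ultimately show "(\<lambda>j. let k = j + 1 in
          zeta (real (2 * k)) / (real k * real (fib (2 * n)) ^ (4 * k)))
        sums (ln (pi / real (fib (2 * n)) ^ 2) + ln (csc (pi / real (fib (2 * n)) ^ 2)))"
    unfolding Let_def F_def[symmetric] by (simp only: times_divide_eq_right mult_1_right)
next
  fix n :: nat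
  assume n: "n \<ge> 2"
  define F where "F = real (fib (2 * n))"
  have F: "F > 1" using fib_double_gt_1[OF n] by (simp add: F_def)
  have FL: "real (fib n) * real (lucas n) = F"
    by (simp add: F_def flip: fib_times_lucas)
  have "(\<lambda>j. zeta (real (j + 2)) * (1 / F) ^ (j + 2) / real (j + 2)) sums
          (ln (Gamma (1 - 1 / F)) - euler_mascheroni * (1 / F))"
    using F by (intro zeta_generating_function) auto
  moreover have "1 - 1 / F = (F - 1) / F" using F by (simp add: field_simps)
  moreover have "zeta (real k) * (1 / F) ^ k / real k = zeta (real k) / (real k * F ^ k)" for k
    by (simp add: power_divide)
  ultimately show "(\<lambda>j. let k = j + 2 in
          zeta (real k) / (real k * (real (fib n) * real (lucas n)) ^ k))
        sums (ln (Gamma ((real (fib (2 * n)) - 1) / real (fib (2 * n))))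
              - euler_mascheroni / real (fib (2 * n)))"
    unfolding Let_def FL F_def[symmetric] by (simp only: times_divide_eq_right mult_1_right)
qed

end
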